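(* Let $F=\frac1n\sum_{i=1}^n F_i:\mathbb{R}^d\to\mathbb{R}^d$ be $L$-Lipschitz and $\mu$-quasi strongly monotone with respect to a point $x_*$ with $F(x_* )=0$, and let the Expected Residual condition hold with parameter $\delta>0$. Let $\bar\omega:=\min\left\{\frac1{4L},\frac{\mu}{18\delta}\right\}$. Let $K\ge1$, $k_0=\lceil K/2\rceil$, and let the step sizes satisfy $\gamma_k=\omega_k$ with $$\omega_k:=\begin{cases}\bar\omega,&\text{if }K\le\frac{2}{\mu\bar\omega},\\ \bar\omega,&\text{if }K>\frac2{\mu\bar\omega}\text{ and }k\le k_0,\\ \dfrac{2}{\frac2{\bar\omega}+\frac\mu2(k-k_0)},&\text{if }K>\frac2{\mu\bar\omega}\text{ and }k>k_0.\end{cases}$$ Then the SPEG iterates with these step sizes satisfy $$R_K^2\le\frac{64R_0^2}{\bar\omega\mu}\exp\left\{-\min\left\{\frac{\mu}{16L},\frac{\mu^2}{72\delta}\right\}K\right\}+\frac{1728\,\sigma_*^2}{\mu^2K},$$ where $R_K^2:=\mathbb{E}\left[\|x_K-x_*\|^2+\|x_K-\hat x_{K-1}\|^2\right]$.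
   Context: Stochastic estimator: $v\in\mathbb{R}^n_+$ is a random sampling vector with distribution $\mathcal D$ satisfying $\mathbb{E}_{\mathcal D}[v_i]=1$ for all $i$, and $F_v(x):=\frac1n\sum_{i=1}^n v_iF_i(x)$, so $\mathbb{E}_{\mathcal D}[F_v(x)]=F(x)$. SPEG (Stochastic Past Extragradient): $\hat x_{-1}=x_0$, the vectors $v_{-1},v_0,v_1,\dots$ are i.i.d. from $\mathcal D$, and for $k\ge0$ $$\hat x_k=x_k-\gamma_kF_{v_{k-1}}(\hat x_{k-1}),\qquad x_{k+1}=x_k-\omega_kF_{v_k}(\hat x_k).$$ $\mu$-quasi strongly monotone ($\mu>0$): $\langle F(x),x-x_*\rangle\ge\mu\|x-x_*\|^2$ for all $x$, where $F(x_* )=0$. Expected Residual (ER) condition with parameter $\delta>0$: for all $x$, $\mathbb{E}\left[\|(F_v(x)-F_v(x_* ))-(F(x)-F(x_* ))\|^2\right]\le\frac\delta2\|x-x_*\|^2$. $\sigma_*^2:=\mathbb{E}\|F_v(x_* )\|^2<\infty$. The quantity $R_0^2$ is $R_K^2$ with $K=0$. *)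

theory Defs
  imports "HOL-Probability.Probability"
begin

definition mean_op :: "('n::finite \<Rightarrow> real^'d \<Rightarrow> real^'d) \<Rightarrow> real^'d \<Rightarrow> real^'d" where
  "mean_op Fi x = (1 / real CARD('n)) *\<^sub>R (\<Sum>i\<in>UNIV. Fi i x)"

definition sampled_op ::
  "('n::finite \<Rightarrow> real^'d \<Rightarrow> real^'d) \<Rightarrow> real^'n \<Rightarrow> real^'d \<Rightarrow> real^'d" where
  "sampled_op Fi w x = (1 / real CARD('n)) *\<^sub>R (\<Sum>i\<in>UNIV. (w $ i) *\<^sub>R Fi i x)"

definition sampling_distribution :: "(real^'n::finite) measure \<Rightarrow> bool" where
  "sampling_distribution D \<longleftrightarrow>
     prob_space D \<and> sets D = sets borel \<and>
     (AE w in D. \<forall>i. 0 \<le> w $ i) \<and>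
     (\<forall>i. integrable D (\<lambda>w. w $ i) \<and> (\<integral>w. w $ i \<partial>D) = 1)"

definition quasi_strongly_monotone ::
  "real \<Rightarrow> (real^'d::finite \<Rightarrow> real^'d) \<Rightarrow> real^'d \<Rightarrow> bool" where
  "quasi_strongly_monotone \<mu> F xs \<longleftrightarrow>
     0 < \<mu> \<and> F xs = 0 \<and> (\<forall>x. inner (F x) (x - xs) \<ge> \<mu> * (norm (x - xs))\<^sup>2)"

text \<open>Second moments are taken as \<^typ>\<open>ennreal\<close>-valued integrals, so that a bound on such a
  moment also asserts that it is finite. (The Bochner integral of a non-integrable function is 0,
  which would make the bounds below hold vacuously.)\<close>

definition expected_residual ::
  "real \<Rightarrow> (real^'n) measure \<Rightarrow> ('n::finite \<Rightarrow> real^'d::finite \<Rightarrow> real^'d) \<Rightarrow> real^'d \<Rightarrow> bool" where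
  "expected_residual \<delta> D Fi xs \<longleftrightarrow>
     (\<forall>x. (\<integral>\<^sup>+ w. ennreal ((norm ((sampled_op Fi w x - sampled_op Fi w xs)
                                - (mean_op Fi x - mean_op Fi xs)))\<^sup>2) \<partial>D)
          \<le> ennreal (\<delta> / 2 * (norm (x - xs))\<^sup>2))"

definition sigma_star_sq ::
  "(real^'n) measure \<Rightarrow> ('n::finite \<Rightarrow> real^'d::finite \<Rightarrow> real^'d) \<Rightarrow> real^'d \<Rightarrow> ennreal" where
  "sigma_star_sq D Fi xs = (\<integral>\<^sup>+ w. ennreal ((norm (sampled_op Fi w xs))\<^sup>2) \<partial>D)"

text \<open>The index set of \<open>v\<close> and \<open>xh\<close> is \<open>{-1, 0, 1, \<dots>}\<close>, hence the type \<^typ>\<open>int\<close>; values at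
  indices below \<open>-1\<close> are never used.\<close>

definition iid_samples ::
  "'a measure \<Rightarrow> (real^'n::finite) measure \<Rightarrow> (int \<Rightarrow> 'a \<Rightarrow> real^'n) \<Rightarrow> bool" where
  "iid_samples M D v \<longleftrightarrow>
     prob_space.indep_vars M (\<lambda>_. borel) v {-1..} \<and> (\<forall>k\<ge>-1. distr M borel (v k) = D)"

definition SPEG ::
  "'a measure \<Rightarrow> ('n::finite \<Rightarrow> real^'d::finite \<Rightarrow> real^'d) \<Rightarrow> (int \<Rightarrow> 'a \<Rightarrow> real^'n) \<Rightarrow>
   (nat \<Rightarrow> real) \<Rightarrow> (nat \<Rightarrow> real) \<Rightarrow> real^'d \<Rightarrow>
   (nat \<Rightarrow> 'a \<Rightarrow> real^'d) \<Rightarrow> (int \<Rightarrow> 'a \<Rightarrow> real^'d) \<Rightarrow> bool" where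
  "SPEG M Fi v \<gamma> \<omega> x0 x xh \<longleftrightarrow>
     (\<forall>s\<in>space M. x 0 s = x0 \<and> xh (-1) s = x0 \<and>
        (\<forall>k. xh (int k) s = x k s - \<gamma> k *\<^sub>R sampled_op Fi (v (int k - 1) s) (xh (int k - 1) s) \<and>
             x (Suc k) s = x k s - \<omega> k *\<^sub>R sampled_op Fi (v (int k) s) (xh (int k) s)))"

definition R_sq ::
  "'a measure \<Rightarrow> real^'d::finite \<Rightarrow> (nat \<Rightarrow> 'a \<Rightarrow> real^'d) \<Rightarrow> (int \<Rightarrow> 'a \<Rightarrow> real^'d) \<Rightarrow> nat \<Rightarrow> ennreal"
  where
  "R_sq M xs x xh K =
     (\<integral>\<^sup>+ s. ennreal ((norm (x K s - xs))\<^sup>2 + (norm (x K s - xh (int K - 1) s))\<^sup>2) \<partial>M)"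

definition switching_step :: "real \<Rightarrow> real \<Rightarrow> nat \<Rightarrow> nat \<Rightarrow> real" where
  "switching_step wb \<mu> K k =
     (let k0 = nat \<lceil>real K / 2\<rceil> in
      if real K \<le> 2 / (\<mu> * wb) then wb
      else if k \<le> k0 then wb
      else 2 / (2 / wb + \<mu> / 2 * (real k - real k0)))"

end

theory Submission
  imports Defs
begin

text \<open>The analysis is a one-step contraction of $R_k^2$ followed by a study of the resulting scalar recursion.

  For the contraction, write $g_k = F_{v_k}(\hat x_k)$. With $\gamma_k = \omega_k = \omega$,
  $$\|x_{k+1}-x_*\|^2+\|x_{k+1}-\hat x_k\|^2 = \|x_k-x_*\|^2 - 2\omega\langle g_k, \hat x_k-x_*\rangle
     - \|x_k-\hat x_k\|^2 + 2\omega^2\|g_k-g_{k-1}\|^2.$$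
  The sample $v_k$ is independent of $x_k$, $\hat x_k$, $\hat x_{k-1}$ and $g_{k-1}$. Averaging over it first
  replaces $g_k$ by $F(\hat x_k)$ in the inner product and splits
  $\mathbb{E}\|g_k-g_{k-1}\|^2$ orthogonally into the noise of $g_k$ and
  $\mathbb{E}\|F(\hat x_k)-g_{k-1}\|^2$. The latter is bounded by the Lipschitz increment
  $F(\hat x_k)-F(\hat x_{k-1})$ and the noise of $g_{k-1}$. By the Expected Residual condition the noise
  at a point $p$ is at most $\delta\|p-x_*\|^2+2\sigma_*^2$ (\<open>sampling_noise_bound\<close>). Since
  $\omega \le \bar\omega$, quasi strong monotonicity and the term $-\|x_k-\hat x_k\|^2$ absorb everything but
  the multiples of $\sigma_*^2$, and
  $$R_{k+1}^2 \le (1-\omega_k\mu/2)\,R_k^2 + 12\,\omega_k^2\sigma_*^2$$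
  (\<open>past_extragradient_step\<close>, \<open>expected_step\<close>, \<open>R_sq_step\<close>). Splitting orthogonally costs
  less than bounding the square of a sum of three terms, and the estimates then leave just the rate
  $\omega_k\mu/2$.

  For the scalar recursion (\<open>switching_recursion_bound\<close>), the constant phase brings the initial error down
  geometrically and leaves noise of order $\bar\omega\sigma_*^2/\mu$, and the decreasing phase lets the noise
  decay like $1/k$. This gives
  $R_K^2 \le e^{-\bar\omega\mu K/4}R_0^2 + 384\,\sigma_*^2/(\mu^2K)$. The claim follows since
  $\bar\omega\mu/4$ is the minimum in the exponent and $\bar\omega\mu \le 1/4$ because $\mu \le L$.\<close>

section \<open>The scalar recursion\<close>

text \<open>Unrolling the recursion, the noise contributes a geometric series with ratio $1 - w\mu/2$, whose sum
  is at most $2/(w\mu)$.\<close>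

lemma constant_phase_bound:
  fixes b :: "nat \<Rightarrow> real"
  assumes "0 < \<mu>" "0 < w" "w * \<mu> \<le> 2" "0 \<le> s" "0 \<le> b 0"
    and rec: "\<And>k. k < m \<Longrightarrow> b (Suc k) \<le> (1 - w * \<mu> / 2) * b k + 12 * w\<^sup>2 * s"
  shows "b m \<le> exp (- (w * \<mu> / 2) * real m) * b 0 + 24 * w * s / \<mu>"
  using rec
proof (induction m)
  case 0
  then show ?case using assms by simp
next
  case (Suc m)
  let ?q = "1 - w * \<mu> / 2"
  have q0: "0 \<le> ?q" using assms by simp
  have "b (Suc m) \<le> ?q * b m + 12 * w\<^sup>2 * s"
    using Suc.prems by simp
  also have "\<dots> \<le> ?q * (exp (- (w * \<mu> / 2) * real m) * b 0 + 24 * w * s / \<mu>) + 12 * w\<^sup>2 * s"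
    using Suc q0 by (intro add_right_mono mult_left_mono) auto
  also have "\<dots> = ?q * exp (- (w * \<mu> / 2) * real m) * b 0 + 24 * w * s / \<mu>"
    using assms by (simp add: field_simps power2_eq_square)
  also have "\<dots> \<le> exp (- (w * \<mu> / 2)) * exp (- (w * \<mu> / 2) * real m) * b 0 + 24 * w * s / \<mu>"
    using assms exp_ge_add_one_self[of "- (w * \<mu> / 2)"]
    by (intro add_right_mono mult_right_mono) auto
  also have "exp (- (w * \<mu> / 2)) * exp (- (w * \<mu> / 2) * real m) = exp (- (w * \<mu> / 2) * real (Suc m))"
    by (simp add: exp_add[symmetric] algebra_simps)
  finally show ?case .
qed

text \<open>With step sizes $4/(\mu(c+j))$ the noise level $192q/(c+j)$ reproduces itself: at $t = c+j$ the
  contraction factor $1-2/t$ removes $2 \cdot 192q/t^2$, the fresh noise restores half of this, and the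
  remaining decrease $192q/t^2$ exceeds the decrease $192q/(t(t+1))$ that the bound demands. The initial
  error $B$ is only required not to grow.\<close>

lemma decreasing_phase_bound:
  fixes b :: "nat \<Rightarrow> real"
  assumes "2 \<le> c" "0 \<le> B" "0 \<le> q" and "b 0 \<le> B + 192 * q / c"
    and rec: "\<And>j. b (Suc j) \<le> (1 - 2 / (c + real j)) * b j + 192 * q / (c + real j)\<^sup>2"
  shows "b j \<le> B + 192 * q / (c + real j)"
proof (induction j)
  case 0
  then show ?case using assms by simp
next
  case (Suc j)
  define t where "t = c + real j"
  have t: "2 \<le> t" using assms by (simp add: t_def)
  have "b (Suc j) \<le> (1 - 2 / t) * b j + 192 * q / t\<^sup>2"
    using rec[of j] by (simp add: t_def)
  also have "\<dots> \<le> (1 - 2 / t) * (B + 192 * q / t) + 192 * q / t\<^sup>2"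
    using Suc t by (intro add_right_mono mult_left_mono) (auto simp: t_def field_simps)
  also have "\<dots> = (1 - 2 / t) * B + 192 * q * (1 / t - 1 / t\<^sup>2)"
    using t by (simp add: field_simps power2_eq_square)
  also have "\<dots> \<le> 1 * B + 192 * q * (1 / (t + 1))"
  proof (intro add_mono mult_right_mono mult_left_mono)
    have "(t - 1) * (t + 1) \<le> t\<^sup>2" by (simp add: algebra_simps power2_eq_square)
    then show "1 / t - 1 / t\<^sup>2 \<le> 1 / (t + 1)"
      using t by (simp add: field_simps power2_eq_square)
  qed (use t assms in auto)
  finally show ?case by (simp add: t_def algebra_simps)
qed

text \<open>The first half of a long run contracts the initial error by $\exp(-w\mu K/4)$ and leaves noise of order
  $ws/\mu$; the second half turns that into noise of order $s/(\mu^2K)$. For $K \le 2/(\mu w)$ the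
  noise $ws/\mu$ is already that small.\<close>

lemma switching_recursion_bound:
  fixes b :: "nat \<Rightarrow> real"
  assumes \<mu>: "0 < \<mu>" and w: "0 < w" and w\<mu>: "w * \<mu> \<le> 1 / 4" and s: "0 \<le> s" and b0: "0 \<le> b 0"
    and K: "1 \<le> K"
    and rec: "\<And>k. b (Suc k) \<le> (1 - switching_step w \<mu> K k * \<mu> / 2) * b k
                 + 12 * (switching_step w \<mu> K k)\<^sup>2 * s"
  shows "b K \<le> exp (- (w * \<mu> / 4) * real K) * b 0 + 384 * s / (\<mu>\<^sup>2 * real K)"
proof (cases "real K \<le> 2 / (\<mu> * w)")
  case True
  then have "switching_step w \<mu> K k = w" for k
    by (simp add: switching_step_def Let_def)
  then have "b K \<le> exp (- (w * \<mu> / 2) * real K) * b 0 + 24 * w * s / \<mu>"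
    using rec assms by (intro constant_phase_bound) auto
  also have "\<dots> \<le> exp (- (w * \<mu> / 4) * real K) * b 0 + 384 * s / (\<mu>\<^sup>2 * real K)"
  proof (intro add_mono mult_right_mono)
    have "w * \<mu> * real K \<le> 2" using True \<mu> w by (simp add: field_simps)
    then have "w * \<mu> * real K * s \<le> 16 * s" using s by (intro mult_right_mono) auto
    then show "24 * w * s / \<mu> \<le> 384 * s / (\<mu>\<^sup>2 * real K)"
      using \<mu> K by (simp add: field_simps power2_eq_square)
  qed (use \<mu> w b0 in auto)
  finally show ?thesis .
next
  case False
  define k0 where "k0 = nat \<lceil>real K / 2\<rceil>"
  \<comment> \<open>This offset writes all the decreasing steps, and also the last constant one, as $4/(\mu(c+j))$.\<close>
  define c where "c = 4 / (\<mu> * w)"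
  have k0: "real K / 2 \<le> real k0" "k0 \<le> K"
    unfolding k0_def by linarith+
  have c: "16 \<le> c" using \<mu> w w\<mu> by (simp add: c_def field_simps)
  have step1: "switching_step w \<mu> K k = w" if "k \<le> k0" for k
    using False that by (simp add: switching_step_def k0_def[symmetric])
  have step2: "switching_step w \<mu> K (k0 + j) = 4 / (\<mu> * (c + real j))" for j
  proof (cases "j = 0")
    case True
    then show ?thesis using step1[of k0] \<mu> w by (simp add: c_def)
  next
    case False
    then have "switching_step w \<mu> K (k0 + j) = 2 / (2 / w + \<mu> / 2 * real j)"
      using \<open>\<not> real K \<le> 2 / (\<mu> * w)\<close> by (simp add: switching_step_def k0_def[symmetric])
    also have "2 / w + \<mu> / 2 * real j = \<mu> * (c + real j) / 2"
      using \<mu> w by (simp add: c_def field_simps)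
    finally show ?thesis by simp
  qed
  define q where "q = s / \<mu>\<^sup>2"
  define B where "B = exp (- (w * \<mu> / 2) * real k0) * b 0"
  have "b k0 \<le> B + 24 * w * s / \<mu>"
    unfolding B_def
  proof (rule constant_phase_bound)
    fix k assume "k < k0"
    then show "b (Suc k) \<le> (1 - w * \<mu> / 2) * b k + 12 * w\<^sup>2 * s"
      using rec[of k] step1[of k] by simp
  qed (use assms in auto)
  also have "24 * w * s / \<mu> = 96 * q / c"
    using \<mu> w by (simp add: c_def q_def field_simps power2_eq_square)
  also have "96 * q / c \<le> 192 * q / c"
    using c s by (simp add: q_def divide_right_mono)
  finally have start: "b k0 \<le> B + 192 * q / c" by simp
  have "b (k0 + j) \<le> B + 192 * q / (c + real j)" for j
  proof (rule decreasing_phase_bound[where b = "\<lambda>j. b (k0 + j)"])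
    fix j
    have "c + real j > 0" using c by simp
    moreover have "4 / (\<mu> * t) * \<mu> / 2 = 2 / t" "12 * (4 / (\<mu> * t))\<^sup>2 * s = 192 * q / t\<^sup>2" if "0 < t" for t
      using \<mu> that by (simp_all add: q_def field_simps power2_eq_square)
    ultimately have eqs: "4 / (\<mu> * (c + real j)) * \<mu> / 2 = 2 / (c + real j)"
      "12 * (4 / (\<mu> * (c + real j)))\<^sup>2 * s = 192 * q / (c + real j)\<^sup>2"
      by blast+
    show "b (k0 + Suc j) \<le> (1 - 2 / (c + real j)) * b (k0 + j) + 192 * q / (c + real j)\<^sup>2"
      using rec[of "k0 + j"] unfolding step2 eqs add_Suc_right .
  qed (use start c s b0 in \<open>auto simp: B_def q_def\<close>)
  from this[of "K - k0"] have "b K \<le> B + 192 * q / (c + real (K - k0))"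
    using k0 by simp
  also have "\<dots> \<le> exp (- (w * \<mu> / 4) * real K) * b 0 + 384 * s / (\<mu>\<^sup>2 * real K)"
  proof (rule add_mono)
    have "w * \<mu> * (real K / 2) \<le> w * \<mu> * real k0" using k0 w \<mu> by (intro mult_left_mono) auto
    then have "- (w * \<mu> / 2) * real k0 \<le> - (w * \<mu> / 4) * real K" by (simp add: mult_ac)
    then show "B \<le> exp (- (w * \<mu> / 4) * real K) * b 0"
      unfolding B_def using b0 by (intro mult_right_mono) (simp_all only: exp_le_cancel_iff)
    have "real k0 < real K / 2 + 1" unfolding k0_def by linarith
    then have "real K / 2 \<le> c + real (K - k0)"
      using c k0 by (simp add: of_nat_diff)
    then have "192 * q / (c + real (K - k0)) \<le> 192 * q / (real K / 2)"
      using K s by (intro divide_left_mono) (auto simp: q_def)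
    also have "\<dots> = 384 * s / (\<mu>\<^sup>2 * real K)" by (simp add: q_def)
    finally show "192 * q / (c + real (K - k0)) \<le> 384 * s / (\<mu>\<^sup>2 * real K)" .
  qed
  finally show ?thesis .
qed

lemma switching_step_range:
  assumes "0 < \<mu>" "0 < w"
  shows "0 < switching_step w \<mu> K k" "switching_step w \<mu> K k \<le> w"
proof -
  have *: "0 < 2 / (2 / w + \<mu> / 2 * t) \<and> 2 / (2 / w + \<mu> / 2 * t) \<le> w" if "0 \<le> t" for t
  proof -
    have "0 < 2 / w" "0 \<le> \<mu> / 2 * t" using assms that by auto
    then have pos: "0 < 2 / w + \<mu> / 2 * t" by (rule add_pos_nonneg)
    then have "2 / (2 / w + \<mu> / 2 * t) \<le> 2 / (2 / w)"
      using \<open>0 < 2 / w\<close> \<open>0 \<le> \<mu> / 2 * t\<close> pos by (intro divide_left_mono mult_pos_pos) auto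
    with pos show ?thesis using assms by simp
  qed
  from *[of "real k - real (nat \<lceil>real K / 2\<rceil>)"] assms
  show "0 < switching_step w \<mu> K k" "switching_step w \<mu> K k \<le> w"
    by (auto simp: switching_step_def Let_def)
qed

section \<open>One step in a real inner product space\<close>

lemma norm_add_sq_le:
  fixes a b :: "'a::real_inner"
  shows "(norm (a + b))\<^sup>2 \<le> 2 * (norm a)\<^sup>2 + 2 * (norm b)\<^sup>2"
  using zero_le_power2[of "norm (a - b)"]
  unfolding power2_norm_eq_inner by (simp add: inner_simps inner_commute)

text \<open>The step without its noise: $y$, $z$ and $h$ stand for $x_k$, $\hat x_{k-1}$ and the stale sample
  $F_{v_{k-1}}(\hat x_{k-1})$, so that $p = \hat x_k$; $G$ and $H$ stand for $F(\hat x_k)$ and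
  $F(\hat x_{k-1})$. The term with $\delta$ on the left is the variance that the fresh sample adds, the
  last term on the right is the error of the stale sample.

  Expanding the two squares gives $\|y-x_*\|^2 - 2w\langle G, p-x_*\rangle - \|y-p\|^2 + 2w^2\|G-h\|^2$.
  Half of $-\|y-p\|^2$ absorbs the Lipschitz part of $\|G-h\|^2$. The other half pays for replacing
  $\|p-x_*\|^2$, which monotonicity provides, by $\|y-x_*\|^2/2 - \|y-p\|^2$.\<close>

lemma past_extragradient_step:
  fixes y z h G H xs p :: "'a::real_inner"
  assumes p: "p = y - w *\<^sub>R h"
    and w: "0 < w" and \<mu>: "0 < \<mu>" and "18 * w * \<delta> \<le> \<mu>" "4 * w * L \<le> 1" "w * \<mu> \<le> 1 / 4" and L0: "0 \<le> L"
    and mono: "\<mu> * (norm (p - xs))\<^sup>2 \<le> inner G (p - xs)"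
    and lip: "norm (G - H) \<le> L * norm (p - z)"
  shows "(norm (y - w *\<^sub>R G - xs))\<^sup>2 + (norm (y - w *\<^sub>R G - p))\<^sup>2 + 2 * w\<^sup>2 * \<delta> * (norm (p - xs))\<^sup>2
    \<le> (1 - 17 / 18 * (w * \<mu>)) * (norm (y - xs))\<^sup>2 + 1 / 2 * (norm (y - z))\<^sup>2
        + 4 * w\<^sup>2 * (norm (H - h))\<^sup>2"
proof -
  define a where "a = (norm (p - xs))\<^sup>2"
  define e where "e = (norm (y - p))\<^sup>2"
  have identity: "(norm (y - w *\<^sub>R G - xs))\<^sup>2 + (norm (y - w *\<^sub>R G - p))\<^sup>2
      = (norm (y - xs))\<^sup>2 - 2 * w * inner G (p - xs) - e + 2 * w\<^sup>2 * (norm (G - h))\<^sup>2"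
    unfolding power2_norm_eq_inner p e_def
    by (simp add: inner_simps inner_commute algebra_simps power2_eq_square)
  have "(norm (G - h))\<^sup>2 \<le> 2 * (norm (G - H))\<^sup>2 + 2 * (norm (H - h))\<^sup>2"
    using norm_add_sq_le[of "G - H" "H - h"] by simp
  also have "(norm (G - H))\<^sup>2 \<le> L\<^sup>2 * (norm (p - z))\<^sup>2"
    using power_mono[OF lip, of 2] by (simp add: power_mult_distrib)
  also have "(norm (p - z))\<^sup>2 \<le> 2 * e + 2 * (norm (y - z))\<^sup>2"
    using norm_add_sq_le[of "p - y" "y - z"] by (simp add: e_def norm_minus_commute)
  finally have diff: "(norm (G - h))\<^sup>2 \<le> 2 * (L\<^sup>2 * (2 * e + 2 * (norm (y - z))\<^sup>2)) + 2 * (norm (H - h))\<^sup>2"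
    by (simp add: mult_left_mono)
  have "2 * w\<^sup>2 * (norm (G - h))\<^sup>2
      \<le> 2 * w\<^sup>2 * (2 * (L\<^sup>2 * (2 * e + 2 * (norm (y - z))\<^sup>2)) + 2 * (norm (H - h))\<^sup>2)"
    by (intro mult_left_mono diff) auto
  also have "\<dots> = 1 / 2 * (4 * w * L)\<^sup>2 * (e + (norm (y - z))\<^sup>2) + 4 * w\<^sup>2 * (norm (H - h))\<^sup>2"
    by (simp add: power2_eq_square algebra_simps)
  also have "(4 * w * L)\<^sup>2 \<le> 1"
    using assms by (simp add: power_le_one)
  then have "1 / 2 * (4 * w * L)\<^sup>2 * (e + (norm (y - z))\<^sup>2) \<le> 1 / 2 * (e + (norm (y - z))\<^sup>2)"
    by (intro mult_right_mono) (auto simp: e_def)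
  finally have A: "2 * w\<^sup>2 * (norm (G - h))\<^sup>2 \<le> 1 / 2 * (e + (norm (y - z))\<^sup>2) + 4 * w\<^sup>2 * (norm (H - h))\<^sup>2"
    by simp
  have B: "2 * w * inner G (p - xs) \<ge> 2 * (w * \<mu>) * a"
    using mult_left_mono[OF mono, of "2 * w"] w by (simp add: a_def algebra_simps)
  have "18 * w * \<delta> * (w * a) \<le> \<mu> * (w * a)"
    using assms by (intro mult_right_mono) (auto simp: a_def)
  then have C: "2 * w\<^sup>2 * \<delta> * a \<le> 1 / 9 * (w * \<mu> * a)"
    by (simp add: power2_eq_square algebra_simps)
  have "(norm (y - xs))\<^sup>2 \<le> 2 * a + 2 * e"
    using norm_add_sq_le[of "p - xs" "y - p"] by (simp add: a_def e_def)
  then have "w * \<mu> * (norm (y - xs))\<^sup>2 \<le> w * \<mu> * (2 * a + 2 * e)"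
    using w \<mu> by (intro mult_left_mono) auto
  then have "17 / 18 * (w * \<mu> * (norm (y - xs))\<^sup>2) \<le> 17 / 9 * (w * \<mu> * a) + 17 / 9 * (w * \<mu> * e)"
    by (simp add: algebra_simps)
  moreover have e0: "0 \<le> e" by (simp add: e_def)
  moreover have "w * \<mu> * e \<le> 1 / 4 * e" using assms by (intro mult_right_mono) (auto simp: e_def)
  ultimately have E: "17 / 18 * (w * \<mu> * (norm (y - xs))\<^sup>2) \<le> 17 / 9 * (w * \<mu> * a) + 1 / 2 * e"
    by linarith
  show ?thesis
    using identity A B C E e0 unfolding a_def[symmetric] by (simp add: algebra_simps)
qed

section \<open>Sampling noise\<close>

lemma sampled_op_measurable:
  assumes "\<And>i. Fi i \<in> borel_measurable borel"
    and f[measurable]: "f \<in> borel_measurable N" and g[measurable]: "g \<in> borel_measurable N"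
  shows "(\<lambda>a. sampled_op Fi (f a) (g a)) \<in> borel_measurable N"
proof -
  have [measurable]: "(\<lambda>a. Fi i (g a)) \<in> borel_measurable N" for i
    using measurable_compose[OF g assms(1)] .
  have [measurable]: "(\<lambda>a. f a $ i) \<in> borel_measurable N" for i
    by (rule measurable_compose[OF f borel_measurable_continuous_onI]) (intro continuous_intros)
  show ?thesis unfolding sampled_op_def by measurable
qed

lemma mean_op_measurable:
  assumes "\<And>i. Fi i \<in> borel_measurable borel"
    and g[measurable]: "g \<in> borel_measurable N"
  shows "(\<lambda>a. mean_op Fi (g a)) \<in> borel_measurable N"
proof -
  note assms(1)[measurable]
  show ?thesis unfolding mean_op_def by measurable
qed

lemma sampled_op_unbiased:
  assumes "sampling_distribution D"
  shows "integrable D (\<lambda>w. sampled_op Fi w p)" "(\<integral>w. sampled_op Fi w p \<partial>D) = mean_op Fi p"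
  using assms unfolding sampled_op_def mean_op_def sampling_distribution_def by simp_all

text \<open>The cross term vanishes. The mean square is a nonnegative integral, so the bound also yields the square
  integrability that makes this legitimate.\<close>

lemma (in prob_space) nn_integral_norm_add_centered:
  fixes N :: "'a \<Rightarrow> 'b::euclidean_space"
  assumes N: "integrable M N" "(\<integral>w. N w \<partial>M) = 0"
    and bound: "(\<integral>\<^sup>+w. ennreal ((norm (N w))\<^sup>2) \<partial>M) \<le> ennreal V" and V: "0 \<le> V"
  shows "(\<integral>\<^sup>+w. ennreal ((norm (a + c *\<^sub>R N w))\<^sup>2) \<partial>M) \<le> ennreal ((norm a)\<^sup>2 + c\<^sup>2 * V)"
proof -
  have [measurable]: "N \<in> borel_measurable M" using N by simp
  have int_sq: "integrable M (\<lambda>w. (norm (N w))\<^sup>2)"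
    using bound by (intro integrableI_bounded) (auto simp: le_less_trans)
  have "ennreal (\<integral>w. (norm (N w))\<^sup>2 \<partial>M) \<le> ennreal V"
    using bound nn_integral_eq_integral[OF int_sq] by simp
  then have le: "(\<integral>w. (norm (N w))\<^sup>2 \<partial>M) \<le> V"
    using V by simp
  have expand: "(norm (a + c *\<^sub>R N w))\<^sup>2 = (norm a)\<^sup>2 + 2 * c * inner a (N w) + c\<^sup>2 * (norm (N w))\<^sup>2" for w
    unfolding power2_norm_eq_inner by (simp add: inner_simps inner_commute power2_eq_square)
  have "integrable M (\<lambda>w. (norm (a + c *\<^sub>R N w))\<^sup>2)"
    unfolding expand using N int_sq by simp
  then have "(\<integral>\<^sup>+w. ennreal ((norm (a + c *\<^sub>R N w))\<^sup>2) \<partial>M) = ennreal (\<integral>w. (norm (a + c *\<^sub>R N w))\<^sup>2 \<partial>M)"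
    by (intro nn_integral_eq_integral) auto
  also have "(\<integral>w. (norm (a + c *\<^sub>R N w))\<^sup>2 \<partial>M) = (norm a)\<^sup>2 + c\<^sup>2 * (\<integral>w. (norm (N w))\<^sup>2 \<partial>M)"
    unfolding expand using N int_sq by (simp add: prob_space)
  also have "\<dots> \<le> (norm a)\<^sup>2 + c\<^sup>2 * V"
    using le by (intro add_left_mono mult_left_mono) auto
  finally show ?thesis by (simp add: ennreal_leI)
qed

text \<open>The noise at $p$ is the residual at $p$ relative to $x_*$, which the Expected Residual condition
  controls, plus the noise $F_v(x_*)$ at the solution.\<close>

lemma sampling_noise_bound:
  assumes meas: "\<And>i. Fi i \<in> borel_measurable borel"
    and D: "sampling_distribution D" and er: "expected_residual \<delta> D Fi xs" and zero: "mean_op Fi xs = 0"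
    and s: "sigma_star_sq D Fi xs = ennreal s" "0 \<le> s" and "0 \<le> \<delta>"
  shows "(\<integral>\<^sup>+w. ennreal ((norm (sampled_op Fi w p - mean_op Fi p))\<^sup>2) \<partial>D)
      \<le> ennreal (\<delta> * (norm (p - xs))\<^sup>2 + 2 * s)"
proof -
  have [measurable_cong]: "sets D = sets borel" using D by (simp add: sampling_distribution_def)
  have [measurable]: "(\<lambda>w. sampled_op Fi w q) \<in> borel_measurable D" for q
    using meas by (intro sampled_op_measurable) auto
  let ?A = "\<lambda>w. (norm (sampled_op Fi w p - sampled_op Fi w xs - (mean_op Fi p - mean_op Fi xs)))\<^sup>2"
  let ?B = "\<lambda>w. (norm (sampled_op Fi w xs))\<^sup>2"
  have "(\<integral>\<^sup>+w. ennreal ((norm (sampled_op Fi w p - mean_op Fi p))\<^sup>2) \<partial>D)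
      \<le> (\<integral>\<^sup>+w. 2 * ennreal (?A w) + 2 * ennreal (?B w) \<partial>D)"
  proof (intro nn_integral_mono)
    fix w
    have "(norm (sampled_op Fi w p - mean_op Fi p))\<^sup>2 \<le> 2 * ?A w + 2 * ?B w"
      using norm_add_sq_le[of "sampled_op Fi w p - sampled_op Fi w xs - (mean_op Fi p - mean_op Fi xs)"
          "sampled_op Fi w xs"] by (simp add: zero)
    then have "ennreal ((norm (sampled_op Fi w p - mean_op Fi p))\<^sup>2) \<le> ennreal (2 * ?A w + 2 * ?B w)"
      by (rule ennreal_leI)
    then show "ennreal ((norm (sampled_op Fi w p - mean_op Fi p))\<^sup>2) \<le> 2 * ennreal (?A w) + 2 * ennreal (?B w)"
      by (simp add: ennreal_plus ennreal_mult)
  qed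
  also have "\<dots> = 2 * (\<integral>\<^sup>+w. ennreal (?A w) \<partial>D) + 2 * (\<integral>\<^sup>+w. ennreal (?B w) \<partial>D)"
    by (simp add: nn_integral_add nn_integral_cmult)
  also have "\<dots> \<le> 2 * ennreal (\<delta> / 2 * (norm (p - xs))\<^sup>2) + 2 * ennreal s"
    using er s by (intro add_mono mult_left_mono) (auto simp: expected_residual_def sigma_star_sq_def)
  also have "\<dots> = ennreal (2 * (\<delta> / 2 * (norm (p - xs))\<^sup>2) + 2 * s)"
    using ennreal_mult[of 2 "\<delta> / 2 * (norm (p - xs))\<^sup>2"] ennreal_mult[of 2 s] assms(7) s
    by (simp add: ennreal_plus)
  finally show ?thesis by simp
qed

section \<open>Independence of the iterates and the fresh sample\<close>

text \<open>The triple $(x_k, \hat x_{k-1}, F_{v_{k-1}}(\hat x_{k-1}))$ as a function of the sample sequence. Carrying the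
  stale sample in the state makes the recursion first order and shows that the state depends on
  $v_{-1},\dots,v_{k-1}$ only, hence is independent of $v_k$.\<close>

fun speg_state ::
  "('n::finite \<Rightarrow> real^'d::finite \<Rightarrow> real^'d) \<Rightarrow> (nat \<Rightarrow> real) \<Rightarrow> real^'d \<Rightarrow> nat \<Rightarrow> (int \<Rightarrow> real^'n)
     \<Rightarrow> (real^'d) \<times> (real^'d) \<times> (real^'d)" where
  "speg_state Fi \<omega> x0 0 f = (x0, x0, sampled_op Fi (f (-1)) x0)"
| "speg_state Fi \<omega> x0 (Suc k) f =
     (case speg_state Fi \<omega> x0 k f of (y, z, h) \<Rightarrow>
        (y - \<omega> k *\<^sub>R sampled_op Fi (f (int k)) (y - \<omega> k *\<^sub>R h),
         y - \<omega> k *\<^sub>R h,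
         sampled_op Fi (f (int k)) (y - \<omega> k *\<^sub>R h)))"

lemma SPEG_state:
  assumes "SPEG M Fi v \<omega> \<omega> x0 x xh" "s \<in> space M"
  shows "speg_state Fi \<omega> x0 k (\<lambda>i. v i s)
    = (x k s, xh (int k - 1) s, sampled_op Fi (v (int k - 1) s) (xh (int k - 1) s))"
  using assms by (induction k) (auto simp: SPEG_def)

lemma speg_state_restrict:
  assumes "{-1..<int k} \<subseteq> J"
  shows "speg_state Fi \<omega> x0 k (restrict f J) = speg_state Fi \<omega> x0 k f"
  using assms
proof (induction k)
  case (Suc k)
  moreover have "{-1..<int k} \<subseteq> J" "int k \<in> J" using Suc.prems by auto
  ultimately show ?case by (simp split: prod.split)
next
  case 0
  then have "- 1 \<in> J" by auto
  then show ?case by simp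
qed

lemma speg_state_measurable:
  assumes meas: "\<And>i. Fi i \<in> borel_measurable borel" and "{-1..<int k} \<subseteq> J"
  shows "speg_state Fi \<omega> x0 k \<in> PiM J (\<lambda>_. borel) \<rightarrow>\<^sub>M borel \<Otimes>\<^sub>M borel \<Otimes>\<^sub>M borel"
  using assms(2)
proof (induction k)
  case 0
  then have "-1 \<in> J" by auto
  then have [measurable]: "(\<lambda>f. f (-1)) \<in> PiM J (\<lambda>_. borel) \<rightarrow>\<^sub>M (borel :: (real^'a) measure)"
    by (auto intro: measurable_component_singleton)
  have [measurable]: "(\<lambda>f. sampled_op Fi (f (-1)) x0) \<in> borel_measurable (PiM J (\<lambda>_. borel))"
    using meas by (intro sampled_op_measurable) auto
  show ?case by simp
next
  case (Suc k)
  then have J: "{-1..<int k} \<subseteq> J" "int k \<in> J" by auto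
  have [measurable]: "(\<lambda>f. f (int k)) \<in> PiM J (\<lambda>_. borel) \<rightarrow>\<^sub>M (borel :: (real^'a) measure)"
    using J by (auto intro: measurable_component_singleton)
  note [measurable] = Suc.IH[OF J(1)]
  let ?S = "speg_state Fi \<omega> x0 k"
  let ?p = "\<lambda>f. fst (?S f) - \<omega> k *\<^sub>R snd (snd (?S f))"
  have [measurable]: "(\<lambda>f. sampled_op Fi (f (int k)) (?p f)) \<in> borel_measurable (PiM J (\<lambda>_. borel))"
    by (rule sampled_op_measurable[OF meas]) measurable
  have "speg_state Fi \<omega> x0 (Suc k) =
     (\<lambda>f. (fst (?S f) - \<omega> k *\<^sub>R sampled_op Fi (f (int k)) (?p f), ?p f, sampled_op Fi (f (int k)) (?p f)))"
    by (simp add: fun_eq_iff split_beta)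
  then show ?case by simp
qed

text \<open>By independence the joint law is a product measure, and Tonelli integrates out the fresh variable first.\<close>

lemma (in prob_space) nn_integral_fresh_variable:
  assumes indep: "indep_vars (\<lambda>_. N) v I" and J: "J \<subseteq> I" "i \<in> I" "i \<notin> J"
    and \<phi>: "\<phi> \<in> PiM J (\<lambda>_. N) \<rightarrow>\<^sub>M S"
    and H[measurable]: "(\<lambda>(t, w). H t w) \<in> borel_measurable (S \<Otimes>\<^sub>M N)"
  shows "(\<integral>\<^sup>+s. H (\<phi> (\<lambda>j\<in>J. v j s)) (v i s) \<partial>M)
    = (\<integral>\<^sup>+s. (\<integral>\<^sup>+w. H (\<phi> (\<lambda>j\<in>J. v j s)) w \<partial>distr M N (v i)) \<partial>M)"
proof -
  \<comment> \<open>The fresh variable is treated as a family over a singleton, because \<^const>\<open>indep_var\<close> requires both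
    variables to have the same type.\<close>
  let ?R = "\<lambda>J s. \<lambda>j\<in>J. v j s" and ?P = "\<lambda>J. PiM J (\<lambda>_. N)"
  have ind: "indep_var (?P J) (?R J) (?P {i}) (?R {i})"
    using J by (intro indep_var_restrict[OF indep]) auto
  have R[measurable]: "?R J \<in> M \<rightarrow>\<^sub>M ?P J" "?R {i} \<in> M \<rightarrow>\<^sub>M ?P {i}"
    using indep_var_rv1[OF ind] indep_var_rv2[OF ind] by auto
  have [measurable]: "v i \<in> M \<rightarrow>\<^sub>M N"
    using indep J by (auto simp: indep_vars_def2)
  have [measurable]: "(\<lambda>f. f i) \<in> ?P {i} \<rightarrow>\<^sub>M N"
    by (rule measurable_component_singleton) simp
  note \<phi>[measurable]
  interpret P: prob_space "distr M (?P {i}) (?R {i})" by (rule prob_space_distr) simp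
  have H'[measurable]: "(\<lambda>(f, g). H (\<phi> f) (g i)) \<in> borel_measurable (?P J \<Otimes>\<^sub>M ?P {i})"
    by measurable
  have inner: "(\<integral>\<^sup>+g. H (\<phi> f) (g i) \<partial>distr M (?P {i}) (?R {i})) = (\<integral>\<^sup>+w. H (\<phi> f) w \<partial>distr M N (v i))"
    if f: "f \<in> space (?P J)" for f
  proof -
    have [measurable]: "H (\<phi> f) \<in> borel_measurable N"
      using measurable_compose[OF measurable_Pair1' H, of "\<phi> f"] measurable_space[OF \<phi> f] by simp
    show ?thesis by (simp add: nn_integral_distr)
  qed
  have "(\<integral>\<^sup>+s. H (\<phi> (?R J s)) (v i s) \<partial>M)
      = (\<integral>\<^sup>+q. (case q of (f, g) \<Rightarrow> H (\<phi> f) (g i)) \<partial>distr M (?P J \<Otimes>\<^sub>M ?P {i}) (\<lambda>s. (?R J s, ?R {i} s)))"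
    by (subst nn_integral_distr) simp_all
  also have "distr M (?P J \<Otimes>\<^sub>M ?P {i}) (\<lambda>s. (?R J s, ?R {i} s)) = distr M (?P J) (?R J) \<Otimes>\<^sub>M distr M (?P {i}) (?R {i})"
    using ind by (simp add: indep_var_distribution_eq)
  also have "(\<integral>\<^sup>+q. (case q of (f, g) \<Rightarrow> H (\<phi> f) (g i)) \<partial>\<dots>)
      = (\<integral>\<^sup>+f. \<integral>\<^sup>+g. H (\<phi> f) (g i) \<partial>distr M (?P {i}) (?R {i}) \<partial>distr M (?P J) (?R J))"
    by (subst P.nn_integral_fst[symmetric]) simp_all
  also have "\<dots> = (\<integral>\<^sup>+s. (\<integral>\<^sup>+g. H (\<phi> (?R J s)) (g i) \<partial>distr M (?P {i}) (?R {i})) \<partial>M)"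
    by (subst nn_integral_distr) simp_all
  also have "\<dots> = (\<integral>\<^sup>+s. (\<integral>\<^sup>+w. H (\<phi> (?R J s)) w \<partial>distr M N (v i)) \<partial>M)"
    by (intro nn_integral_cong inner measurable_space[OF R(1)])
  finally show ?thesis .
qed

section \<open>One-step contraction in expectation\<close>

text \<open>The step size conditions are what the one-step contraction uses; every step size of the switching rule
  is at most $\bar\omega$ and therefore satisfies them. The finite $\sigma_*^2$ appears as the real
  number $s$.\<close>

locale speg_process = prob_space M for M :: "'a measure" +
  fixes Fi :: "'n::finite \<Rightarrow> real^'d::finite \<Rightarrow> real^'d"
    and D :: "(real^'n) measure"
    and v :: "int \<Rightarrow> 'a \<Rightarrow> real^'n"
    and x :: "nat \<Rightarrow> 'a \<Rightarrow> real^'d"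
    and xh :: "int \<Rightarrow> 'a \<Rightarrow> real^'d"
    and x0 xs :: "real^'d"
    and L \<mu> \<delta> s :: real
    and \<omega> :: "nat \<Rightarrow> real"
  assumes Fi: "\<And>i. Fi i \<in> borel_measurable borel"
    and sampling: "sampling_distribution D"
    and lipschitz: "L-lipschitz_on UNIV (mean_op Fi)"
    and monotone: "quasi_strongly_monotone \<mu> (mean_op Fi) xs"
    and \<delta>: "0 < \<delta>"
    and residual: "expected_residual \<delta> D Fi xs"
    and s: "sigma_star_sq D Fi xs = ennreal s" "0 \<le> s"
    and \<omega>: "\<And>k. 0 < \<omega> k" "\<And>k. 18 * \<omega> k * \<delta> \<le> \<mu>" "\<And>k. 4 * \<omega> k * L \<le> 1" "\<And>k. \<omega> k * \<mu> \<le> 1 / 4"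
    and iid: "iid_samples M D v"
    and speg: "SPEG M Fi v \<omega> \<omega> x0 x xh"
begin

abbreviation F where "F \<equiv> mean_op Fi"

abbreviation state where "state k a \<equiv> speg_state Fi \<omega> x0 k (\<lambda>i. v i a)"

lemma \<mu>_pos: "0 < \<mu>" and F_xs: "F xs = 0" and strong: "\<mu> * (norm (q - xs))\<^sup>2 \<le> inner (F q) (q - xs)"
  using monotone by (auto simp: quasi_strongly_monotone_def)

lemma L_nonneg: "0 \<le> L" and F_lipschitz: "norm (F p - F q) \<le> L * norm (p - q)"
  using lipschitz by (auto simp: lipschitz_on_def dist_norm)

lemma prob_D: "prob_space D"
  using sampling by (simp add: sampling_distribution_def)

lemma sets_D [measurable_cong]: "sets D = sets borel"
  using sampling by (simp add: sampling_distribution_def)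

lemma v_measurable [measurable]: "-1 \<le> i \<Longrightarrow> v i \<in> borel_measurable M"
  using iid by (auto simp: iid_samples_def indep_vars_def2)

lemma distr_v: "-1 \<le> i \<Longrightarrow> distr M borel (v i) = D"
  using iid by (auto simp: iid_samples_def)

lemma sampled_op_measurable' [measurable (raw)]:
  "f \<in> borel_measurable N \<Longrightarrow> g \<in> borel_measurable N \<Longrightarrow> (\<lambda>a. sampled_op Fi (f a) (g a)) \<in> borel_measurable N"
  using Fi by (rule sampled_op_measurable)

lemma F_measurable [measurable (raw)]: "g \<in> borel_measurable N \<Longrightarrow> (\<lambda>a. F (g a)) \<in> borel_measurable N"
  using Fi by (rule mean_op_measurable)

lemma state_measurable [measurable]: "state k \<in> M \<rightarrow>\<^sub>M borel \<Otimes>\<^sub>M borel \<Otimes>\<^sub>M borel"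
proof -
  have "(\<lambda>a. speg_state Fi \<omega> x0 k (\<lambda>i\<in>{-1..<int k}. v i a)) \<in> M \<rightarrow>\<^sub>M borel \<Otimes>\<^sub>M borel \<Otimes>\<^sub>M borel"
    by (rule measurable_compose[OF _ speg_state_measurable[OF Fi order_refl]])
       (auto intro!: measurable_restrict v_measurable)
  then show ?thesis by (simp add: speg_state_restrict)
qed

lemma fresh_sample:
  assumes "(\<lambda>(t, w). H t w) \<in> borel_measurable ((borel \<Otimes>\<^sub>M borel \<Otimes>\<^sub>M borel) \<Otimes>\<^sub>M borel)"
  shows "(\<integral>\<^sup>+a. H (state k a) (v (int k) a) \<partial>M) = (\<integral>\<^sup>+a. \<integral>\<^sup>+w. H (state k a) w \<partial>D \<partial>M)"
proof -
  have "indep_vars (\<lambda>_. borel) v {-1..}" using iid by (simp add: iid_samples_def)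
  from nn_integral_fresh_variable[OF this _ _ _ speg_state_measurable[OF Fi order_refl] assms, of k "int k"]
  show ?thesis by (simp add: speg_state_restrict distr_v atLeastLessThan_def)
qed

lemma noise_bound:
  "(\<integral>\<^sup>+w. ennreal ((norm (sampled_op Fi w p - F p))\<^sup>2) \<partial>D) \<le> ennreal (\<delta> * (norm (p - xs))\<^sup>2 + 2 * s)"
  using sampling_noise_bound[OF Fi sampling residual F_xs s] \<delta> by simp

text \<open>Averaging over the fresh sample alone, with the past fixed: both squares gain the same variance
  $\omega_k^2\,\mathbb{E}\|F_v(p)-F(p)\|^2$, and the cross terms vanish.\<close>

lemma expected_step:
  assumes p: "p = y - \<omega> k *\<^sub>R h"
  shows "(\<integral>\<^sup>+w. ennreal ((norm (y - \<omega> k *\<^sub>R sampled_op Fi w p - xs))\<^sup>2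
                      + (norm (y - \<omega> k *\<^sub>R sampled_op Fi w p - p))\<^sup>2) \<partial>D)
    \<le> ennreal ((1 - 17 / 18 * (\<omega> k * \<mu>)) * (norm (y - xs))\<^sup>2 + 1 / 2 * (norm (y - z))\<^sup>2
                + 4 * (\<omega> k)\<^sup>2 * (norm (F z - h))\<^sup>2 + 4 * (\<omega> k)\<^sup>2 * s)"
proof -
  interpret D: prob_space D by (rule prob_D)
  let ?N = "\<lambda>w. sampled_op Fi w p - F p"
  define V where "V = \<delta> * (norm (p - xs))\<^sup>2 + 2 * s"
  have V: "0 \<le> V" using \<delta> s by (simp add: V_def)
  have N: "integrable D ?N" "(\<integral>w. ?N w \<partial>D) = 0"
    using sampled_op_unbiased[OF sampling, of Fi p] by (simp_all add: D.prob_space)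
  have split: "(\<integral>\<^sup>+w. ennreal ((norm (y - \<omega> k *\<^sub>R sampled_op Fi w p - q))\<^sup>2) \<partial>D)
      \<le> ennreal ((norm (y - \<omega> k *\<^sub>R F p - q))\<^sup>2 + (\<omega> k)\<^sup>2 * V)" for q
  proof -
    have eq: "y - \<omega> k *\<^sub>R sampled_op Fi w p - q = (y - \<omega> k *\<^sub>R F p - q) + (- \<omega> k) *\<^sub>R ?N w" for w
      by (simp add: algebra_simps)
    show ?thesis unfolding eq
      using D.nn_integral_norm_add_centered[OF N noise_bound[of p, folded V_def] V,
          of "y - \<omega> k *\<^sub>R F p - q" "- \<omega> k"] unfolding power2_minus .
  qed
  have "(\<integral>\<^sup>+w. ennreal ((norm (y - \<omega> k *\<^sub>R sampled_op Fi w p - xs))\<^sup>2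
                      + (norm (y - \<omega> k *\<^sub>R sampled_op Fi w p - p))\<^sup>2) \<partial>D)
     = (\<integral>\<^sup>+w. ennreal ((norm (y - \<omega> k *\<^sub>R sampled_op Fi w p - xs))\<^sup>2) \<partial>D)
       + (\<integral>\<^sup>+w. ennreal ((norm (y - \<omega> k *\<^sub>R sampled_op Fi w p - p))\<^sup>2) \<partial>D)"
    by (simp add: ennreal_plus nn_integral_add)
  also have "\<dots> \<le> ennreal ((norm (y - \<omega> k *\<^sub>R F p - xs))\<^sup>2 + (\<omega> k)\<^sup>2 * V)
       + ennreal ((norm (y - \<omega> k *\<^sub>R F p - p))\<^sup>2 + (\<omega> k)\<^sup>2 * V)"
    by (intro add_mono split)
  also have "\<dots> = ennreal ((norm (y - \<omega> k *\<^sub>R F p - xs))\<^sup>2 + (norm (y - \<omega> k *\<^sub>R F p - p))\<^sup>2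
                      + 2 * (\<omega> k)\<^sup>2 * \<delta> * (norm (p - xs))\<^sup>2 + 4 * (\<omega> k)\<^sup>2 * s)"
  proof -
    have "0 \<le> (norm (y - \<omega> k *\<^sub>R F p - q))\<^sup>2 + (\<omega> k)\<^sup>2 * V" for q using V by simp
    from this[of xs] this[of p] show ?thesis
      by (subst ennreal_plus[symmetric]) (simp_all only: V_def, simp add: algebra_simps)
  qed
  also have "\<dots> \<le> ennreal ((1 - 17 / 18 * (\<omega> k * \<mu>)) * (norm (y - xs))\<^sup>2 + 1 / 2 * (norm (y - z))\<^sup>2
                + 4 * (\<omega> k)\<^sup>2 * (norm (F z - h))\<^sup>2 + 4 * (\<omega> k)\<^sup>2 * s)"
    using past_extragradient_step[OF p \<omega>(1) \<mu>_pos \<omega>(2-4) L_nonneg strong F_lipschitz]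
    by (intro ennreal_leI add_right_mono)
  finally show ?thesis .
qed

text \<open>The stale sample $v_{k-1}$ was in turn independent of $\hat x_{k-1}$, so its noise obeys the same bound
  once it is averaged.\<close>

lemma past_noise_bound:
  "(\<integral>\<^sup>+a. (case state k a of (y, z, h) \<Rightarrow> ennreal ((norm (F z - h))\<^sup>2)) \<partial>M)
    \<le> (\<integral>\<^sup>+a. (case state k a of (y, z, h) \<Rightarrow> ennreal (\<delta> * (norm (z - xs))\<^sup>2 + 2 * s)) \<partial>M)"
proof (cases k)
  case 0
  \<comment> \<open>Here the point is the constant $\hat x_{-1} = x_0$, and the law of $v_{-1}$ alone decides.\<close>
  have "(\<integral>\<^sup>+a. ennreal ((norm (F x0 - sampled_op Fi (v (-1) a) x0))\<^sup>2) \<partial>M)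
      = (\<integral>\<^sup>+w. ennreal ((norm (sampled_op Fi w x0 - F x0))\<^sup>2) \<partial>distr M borel (v (-1)))"
    by (subst nn_integral_distr) (simp_all add: norm_minus_commute)
  also have "\<dots> \<le> ennreal (\<delta> * (norm (x0 - xs))\<^sup>2 + 2 * s)"
    by (simp add: distr_v noise_bound)
  finally show ?thesis using 0 by (simp add: emeasure_space_1)
next
  case (Suc j)
  let ?p = "\<lambda>(y, z, h). y - \<omega> j *\<^sub>R h"
  let ?H = "\<lambda>t w. ennreal ((norm (sampled_op Fi w (?p t) - F (?p t)))\<^sup>2)"
  have "(\<integral>\<^sup>+a. (case state k a of (y, z, h) \<Rightarrow> ennreal ((norm (F z - h))\<^sup>2)) \<partial>M)
      = (\<integral>\<^sup>+a. ?H (state j a) (v (int j) a) \<partial>M)"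
    unfolding Suc by (intro nn_integral_cong) (simp add: norm_minus_commute split: prod.split)
  also have "\<dots> = (\<integral>\<^sup>+a. \<integral>\<^sup>+w. ?H (state j a) w \<partial>D \<partial>M)"
    by (rule fresh_sample) (simp add: split_beta)
  also have "\<dots> \<le> (\<integral>\<^sup>+a. ennreal (\<delta> * (norm (?p (state j a) - xs))\<^sup>2 + 2 * s) \<partial>M)"
    by (intro nn_integral_mono noise_bound)
  also have "\<dots> = (\<integral>\<^sup>+a. (case state k a of (y, z, h) \<Rightarrow> ennreal (\<delta> * (norm (z - xs))\<^sup>2 + 2 * s)) \<partial>M)"
    unfolding Suc by (intro nn_integral_cong) (simp split: prod.split)
  finally show ?thesis .
qed

lemma R_sq_state:
  "R_sq M xs x xh k = (\<integral>\<^sup>+a. (case state k a of (y, z, h) \<Rightarrow> ennreal ((norm (y - xs))\<^sup>2 + (norm (y - z))\<^sup>2)) \<partial>M)"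
  unfolding R_sq_def by (intro nn_integral_cong) (simp add: SPEG_state[OF speg])

text \<open>The fresh noise costs $4\omega_k^2 s$ and the stale noise $8\omega_k^2 s$. The stale noise also contributes
  $4\omega_k^2\delta\|z-x_*\|^2 \le \frac49\omega_k\mu(\|y-x_*\|^2+\|y-z\|^2)$, and
  $\frac{17}{18}-\frac49 = \frac12$ is the contraction rate that remains.\<close>

lemma R_sq_step:
  "R_sq M xs x xh (Suc k) \<le> ennreal (1 - \<omega> k * \<mu> / 2) * R_sq M xs x xh k + ennreal (12 * (\<omega> k)\<^sup>2 * s)"
proof -
  let ?Y = "\<lambda>a. fst (state k a)" and ?Z = "\<lambda>a. fst (snd (state k a))" and ?h = "\<lambda>a. snd (snd (state k a))"
  let ?p = "\<lambda>t. fst t - \<omega> k *\<^sub>R snd (snd t)"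
  let ?x = "\<lambda>t w. fst t - \<omega> k *\<^sub>R sampled_op Fi w (?p t)"
  let ?H = "\<lambda>t w. ennreal ((norm (?x t w - xs))\<^sup>2 + (norm (?x t w - ?p t))\<^sup>2)"
  \<comment> \<open>\<open>P\<close> collects the part of the conditional bound without the stale noise, \<open>Q\<close> bounds that noise.\<close>
  define P where "P = (\<lambda>a. (1 - 17 / 18 * (\<omega> k * \<mu>)) * (norm (?Y a - xs))\<^sup>2 + 1 / 2 * (norm (?Y a - ?Z a))\<^sup>2 + 4 * (\<omega> k)\<^sup>2 * s)"
  define Q where "Q = (\<lambda>a. \<delta> * (norm (?Z a - xs))\<^sup>2 + 2 * s)"
  have [measurable]: "P \<in> borel_measurable M" "Q \<in> borel_measurable M"
    unfolding P_def Q_def by measurable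
  have P0: "0 \<le> P a" and Q0: "0 \<le> Q a" for a
    using \<omega>(4)[of k] s \<delta> by (auto simp: P_def Q_def)
  have "R_sq M xs x xh (Suc k) = (\<integral>\<^sup>+a. ?H (state k a) (v (int k) a) \<partial>M)"
    unfolding R_sq_state by (intro nn_integral_cong) (simp add: split_beta)
  also have "\<dots> = (\<integral>\<^sup>+a. \<integral>\<^sup>+w. ?H (state k a) w \<partial>D \<partial>M)"
    by (rule fresh_sample) (simp add: split_beta)
  also have "\<dots> \<le> (\<integral>\<^sup>+a. ennreal (P a) + ennreal (4 * (\<omega> k)\<^sup>2) * ennreal ((norm (F (?Z a) - ?h a))\<^sup>2) \<partial>M)"
  proof (intro nn_integral_mono)
    fix a
    have "(\<integral>\<^sup>+w. ?H (state k a) w \<partial>D) \<le> ennreal (P a + 4 * (\<omega> k)\<^sup>2 * (norm (F (?Z a) - ?h a))\<^sup>2)"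
      using expected_step[OF refl, where z = "?Z a" and k = k and y = "?Y a" and h = "?h a"] by (simp add: P_def algebra_simps)
    then show "(\<integral>\<^sup>+w. ?H (state k a) w \<partial>D)
      \<le> ennreal (P a) + ennreal (4 * (\<omega> k)\<^sup>2) * ennreal ((norm (F (?Z a) - ?h a))\<^sup>2)"
      using P0 by (simp add: ennreal_plus ennreal_mult')
  qed
  also have "\<dots> = (\<integral>\<^sup>+a. ennreal (P a) \<partial>M) + ennreal (4 * (\<omega> k)\<^sup>2) * (\<integral>\<^sup>+a. ennreal ((norm (F (?Z a) - ?h a))\<^sup>2) \<partial>M)"
    by (simp add: nn_integral_add nn_integral_cmult)
  also have "\<dots> \<le> (\<integral>\<^sup>+a. ennreal (P a) \<partial>M) + ennreal (4 * (\<omega> k)\<^sup>2) * (\<integral>\<^sup>+a. ennreal (Q a) \<partial>M)"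
    using past_noise_bound[of k] by (intro add_left_mono mult_left_mono) (auto simp: split_beta Q_def)
  also have "\<dots> = (\<integral>\<^sup>+a. ennreal (P a + 4 * (\<omega> k)\<^sup>2 * Q a) \<partial>M)"
    using P0 Q0 by (simp add: ennreal_plus ennreal_mult' nn_integral_add nn_integral_cmult)
  also have "\<dots> \<le> (\<integral>\<^sup>+a. ennreal (1 - \<omega> k * \<mu> / 2) * ennreal ((norm (?Y a - xs))\<^sup>2 + (norm (?Y a - ?Z a))\<^sup>2)
                     + ennreal (12 * (\<omega> k)\<^sup>2 * s) \<partial>M)"
  proof (intro nn_integral_mono)
    fix a
    let ?u = "(norm (?Y a - xs))\<^sup>2" and ?e = "(norm (?Y a - ?Z a))\<^sup>2"
    have "(norm (?Z a - xs))\<^sup>2 \<le> 2 * ?u + 2 * ?e"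
      using norm_add_sq_le[of "?Z a - ?Y a" "?Y a - xs"] by (simp add: norm_minus_commute)
    then have "4 * (\<omega> k)\<^sup>2 * \<delta> * (norm (?Z a - xs))\<^sup>2 \<le> 4 * (\<omega> k)\<^sup>2 * \<delta> * (2 * ?u + 2 * ?e)"
      using \<delta> by (intro mult_left_mono) auto
    also have "\<dots> = 18 * \<omega> k * \<delta> * (4 / 9 * \<omega> k * (?u + ?e))"
      by (simp add: power2_eq_square algebra_simps)
    also have "\<dots> \<le> \<mu> * (4 / 9 * \<omega> k * (?u + ?e))"
      using \<omega>(1)[of k] \<omega>(2)[of k] by (intro mult_right_mono) auto
    finally have "P a + 4 * (\<omega> k)\<^sup>2 * Q a
      \<le> (1 - 17 / 18 * (\<omega> k * \<mu>)) * ?u + 1 / 2 * ?e + 4 / 9 * (\<omega> k * \<mu>) * (?u + ?e) + 12 * (\<omega> k)\<^sup>2 * s"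
      by (simp add: P_def Q_def algebra_simps)
    also have "\<dots> \<le> (1 - \<omega> k * \<mu> / 2) * (?u + ?e) + 12 * (\<omega> k)\<^sup>2 * s"
    proof -
      have "\<omega> k * \<mu> * ?e \<le> 1 / 4 * ?e" using \<omega>(4)[of k] by (intro mult_right_mono) auto
      moreover have "0 \<le> ?e" by simp
      ultimately have "1 / 2 * ?e + 17 / 18 * (\<omega> k * \<mu> * ?e) \<le> ?e" by linarith
      then show ?thesis by (simp add: algebra_simps)
    qed
    finally have "ennreal (P a + 4 * (\<omega> k)\<^sup>2 * Q a)
      \<le> ennreal ((1 - \<omega> k * \<mu> / 2) * (?u + ?e) + 12 * (\<omega> k)\<^sup>2 * s)" by (rule ennreal_leI)
    also have "\<dots> = ennreal (1 - \<omega> k * \<mu> / 2) * ennreal (?u + ?e) + ennreal (12 * (\<omega> k)\<^sup>2 * s)"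
      using \<omega>(4)[of k] s by (subst ennreal_plus) (auto simp: ennreal_mult simp del: ennreal_plus)
    finally show "ennreal (P a + 4 * (\<omega> k)\<^sup>2 * Q a)
      \<le> ennreal (1 - \<omega> k * \<mu> / 2) * ennreal (?u + ?e) + ennreal (12 * (\<omega> k)\<^sup>2 * s)" .
  qed
  also have "\<dots> = ennreal (1 - \<omega> k * \<mu> / 2) * R_sq M xs x xh k + ennreal (12 * (\<omega> k)\<^sup>2 * s)"
    unfolding R_sq_state split_beta
    by (simp add: nn_integral_add nn_integral_cmult emeasure_space_1 del: ennreal_plus)
  finally show ?thesis .
qed

lemma R_sq_0: "R_sq M xs x xh 0 = ennreal ((norm (x0 - xs))\<^sup>2)"
  unfolding R_sq_state by (simp add: emeasure_space_1)

lemma R_sq_finite: "R_sq M xs x xh k < \<infinity>"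
proof (induction k)
  case (Suc k)
  have "ennreal (1 - \<omega> k * \<mu> / 2) * R_sq M xs x xh k + ennreal (12 * (\<omega> k)\<^sup>2 * s) < \<infinity>"
    using Suc by (simp add: ennreal_mult_less_top)
  then show ?case using R_sq_step[of k] by (rule le_less_trans[rotated])
qed (simp add: R_sq_0)

lemma R_sq_real_step:
  "enn2real (R_sq M xs x xh (Suc k))
    \<le> (1 - \<omega> k * \<mu> / 2) * enn2real (R_sq M xs x xh k) + 12 * (\<omega> k)\<^sup>2 * s"
proof -
  have q: "0 \<le> 1 - \<omega> k * \<mu> / 2" using \<omega>(4)[of k] by simp
  have "R_sq M xs x xh k = ennreal (enn2real (R_sq M xs x xh k))"
    using R_sq_finite[of k] by simp
  then have "R_sq M xs x xh (Suc k)
      \<le> ennreal (1 - \<omega> k * \<mu> / 2) * ennreal (enn2real (R_sq M xs x xh k)) + ennreal (12 * (\<omega> k)\<^sup>2 * s)"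
    using R_sq_step[of k] by simp
  also have "\<dots> = ennreal ((1 - \<omega> k * \<mu> / 2) * enn2real (R_sq M xs x xh k) + 12 * (\<omega> k)\<^sup>2 * s)"
    using q s by (subst ennreal_plus) (auto simp: ennreal_mult)
  finally show ?thesis
    using q s by (intro enn2real_leI) auto
qed

end

section \<open>Convergence with switching step sizes\<close>

text \<open>A unit displacement from $x_*$ compares both conditions. In particular $L > 0$, so that $\bar\omega$ is
  positive.\<close>

lemma strongly_monotone_modulus_le_lipschitz:
  fixes F :: "real^'d::finite \<Rightarrow> real^'d"
  assumes "quasi_strongly_monotone \<mu> F xs" "L-lipschitz_on UNIV F"
  shows "\<mu> \<le> L"
proof -
  define e :: "real^'d" where "e = axis undefined 1"
  have e: "norm e = 1" by (simp add: e_def norm_axis_1)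
  have "\<mu> * (norm (xs + e - xs))\<^sup>2 \<le> inner (F (xs + e)) (xs + e - xs)" and zero: "F xs = 0"
    using assms(1) unfolding quasi_strongly_monotone_def by blast+
  then have "\<mu> \<le> inner (F (xs + e)) e" using e by simp
  also have "\<dots> \<le> norm (F (xs + e))" using norm_cauchy_schwarz[of "F (xs + e)" e] e by simp
  also have "\<dots> \<le> L"
    using lipschitz_onD[OF assms(2), of "xs + e" xs] e zero by (simp add: dist_norm)
  finally show ?thesis .
qed

theorem theorem2p3:
  fixes Fi :: "'n::finite \<Rightarrow> real^'d::finite \<Rightarrow> real^'d"
    and D :: "(real^'n) measure"
    and M :: "'a measure"
    and v :: "int \<Rightarrow> 'a \<Rightarrow> real^'n"
    and x :: "nat \<Rightarrow> 'a \<Rightarrow> real^'d"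
    and xh :: "int \<Rightarrow> 'a \<Rightarrow> real^'d"
    and x0 xs :: "real^'d"
    and L \<mu> \<delta> wb :: real
    and \<gamma> \<omega> :: "nat \<Rightarrow> real"
    and K :: nat
  assumes "\<And>i. Fi i \<in> borel_measurable borel"
    and "sampling_distribution D"
    and "L-lipschitz_on UNIV (mean_op Fi)"
    and "quasi_strongly_monotone \<mu> (mean_op Fi) xs"
    and "\<delta> > 0"
    and "expected_residual \<delta> D Fi xs"
    and "sigma_star_sq D Fi xs < \<infinity>"
    and "wb = min (1 / (4 * L)) (\<mu> / (18 * \<delta>))"
    and "K \<ge> 1"
    and "\<And>k. \<gamma> k = \<omega> k"
    and "\<And>k. \<omega> k = switching_step wb \<mu> K k"
    and "prob_space M"
    and "iid_samples M D v"
    and "SPEG M Fi v \<gamma> \<omega> x0 x xh"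
  shows "R_sq M xs x xh K
           \<le> 64 * R_sq M xs x xh 0 / ennreal (wb * \<mu>)
               * ennreal (exp (- min (\<mu> / (16 * L)) (\<mu>\<^sup>2 / (72 * \<delta>)) * real K))
             + 1728 * sigma_star_sq D Fi xs / ennreal (\<mu>\<^sup>2 * real K)"
proof -
  define s where "s = enn2real (sigma_star_sq D Fi xs)"
  have s: "sigma_star_sq D Fi xs = ennreal s" "0 \<le> s"
    using assms(7) by (simp_all add: s_def)
  have \<mu>: "0 < \<mu>" using assms(4) by (simp add: quasi_strongly_monotone_def)
  have \<mu>L: "\<mu> \<le> L" using assms(3,4) by (rule strongly_monotone_modulus_le_lipschitz[rotated])
  then have L: "0 < L" using \<mu> by simp
  have wb: "0 < wb" using \<mu> L assms(5) by (simp add: assms(8))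
  have "wb \<le> 1 / (4 * L)" "wb \<le> \<mu> / (18 * \<delta>)" by (simp_all add: assms(8))
  then have wbL: "4 * wb * L \<le> 1" and wb\<delta>: "18 * wb * \<delta> \<le> \<mu>"
    using L assms(5) by (simp_all add: field_simps)
  have "wb * \<mu> \<le> wb * L" using \<mu>L wb by (intro mult_left_mono) auto
  then have wb\<mu>: "wb * \<mu> \<le> 1 / 4" using wbL by simp
  let ?\<omega> = "switching_step wb \<mu> K"
  have step: "0 < ?\<omega> k" "?\<omega> k \<le> wb" for k
    using switching_step_range[OF \<mu> wb] by auto
  have scaled: "?\<omega> k * c \<le> wb * c" if "0 \<le> c" for k c
    using step that by (intro mult_right_mono) auto
  have eqs: "\<gamma> = ?\<omega>" "\<omega> = ?\<omega>" using assms(10,11) by auto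
  interpret prob_space M by (rule assms(12))
  interpret speg_process M Fi D v x xh x0 xs L \<mu> \<delta> s ?\<omega>
  proof
    show "18 * ?\<omega> k * \<delta> \<le> \<mu>" for k
      using scaled[of \<delta> k] wb\<delta> assms(5) by linarith
    show "4 * ?\<omega> k * L \<le> 1" for k
      using scaled[of L k] wbL L by linarith
    show "?\<omega> k * \<mu> \<le> 1 / 4" for k
      using scaled[of \<mu> k] wb\<mu> \<mu> by linarith
    show "SPEG M Fi v ?\<omega> ?\<omega> x0 x xh" using assms(14) by (simp add: eqs)
  qed (use assms s step in auto)
  let ?r = "\<lambda>k. enn2real (R_sq M xs x xh k)"
  let ?m = "min (\<mu> / (16 * L)) (\<mu>\<^sup>2 / (72 * \<delta>))"
  have r: "R_sq M xs x xh k = ennreal (?r k)" for k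
    using R_sq_finite[of k] by simp
  have rate: "wb * \<mu> / 4 = ?m"
    using \<mu> by (simp add: assms(8) min_mult_distrib_right min_divide_distrib_right power2_eq_square)
  have "?r K \<le> exp (- (wb * \<mu> / 4) * real K) * ?r 0 + 384 * s / (\<mu>\<^sup>2 * real K)"
    using \<mu> wb wb\<mu> s(2) assms(9) R_sq_real_step by (intro switching_recursion_bound) auto
  also have "\<dots> \<le> (64 * ?r 0 / (wb * \<mu>)) * exp (- ?m * real K) + 1728 * s / (\<mu>\<^sup>2 * real K)"
  proof (rule add_mono)
    have "wb * \<mu> * ?r 0 \<le> 64 * ?r 0" using wb\<mu> by (intro mult_right_mono) auto
    then have "?r 0 \<le> 64 * ?r 0 / (wb * \<mu>)" using \<mu> wb by (simp add: pos_le_divide_eq mult.commute)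
    then have "exp (- ?m * real K) * ?r 0 \<le> exp (- ?m * real K) * (64 * ?r 0 / (wb * \<mu>))"
      by (intro mult_left_mono) auto
    then show "exp (- (wb * \<mu> / 4) * real K) * ?r 0 \<le> (64 * ?r 0 / (wb * \<mu>)) * exp (- ?m * real K)"
      unfolding rate by (simp only: mult.commute)
    show "384 * s / (\<mu>\<^sup>2 * real K) \<le> 1728 * s / (\<mu>\<^sup>2 * real K)"
      using s(2) by (intro divide_right_mono) auto
  qed
  finally have "R_sq M xs x xh K
      \<le> ennreal ((64 * ?r 0 / (wb * \<mu>)) * exp (- ?m * real K) + 1728 * s / (\<mu>\<^sup>2 * real K))"
    by (subst r) (rule ennreal_leI)
  also have "\<dots> = ennreal (64 * ?r 0 / (wb * \<mu>)) * ennreal (exp (- ?m * real K)) + ennreal (1728 * s / (\<mu>\<^sup>2 * real K))"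
    using s(2) \<mu> wb by (subst ennreal_plus) (simp_all del: times_divide_eq_left add: ennreal_mult''[OF exp_ge_zero])
  also have "ennreal (64 * ?r 0 / (wb * \<mu>)) = 64 * R_sq M xs x xh 0 / ennreal (wb * \<mu>)"
    using \<mu> wb r[of 0] ennreal_mult[of 64 "?r 0"] by (simp add: divide_ennreal[symmetric])
  also have "ennreal (1728 * s / (\<mu>\<^sup>2 * real K)) = 1728 * sigma_star_sq D Fi xs / ennreal (\<mu>\<^sup>2 * real K)"
    using \<mu> assms(9) s ennreal_mult[of 1728 s] by (simp add: divide_ennreal[symmetric])
  finally show ?thesis .
qed

end
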